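(* Let $\mathcal{H}$ be a separable Hilbert space, let $g,h\in\mathcal{H}$, and let $A$ and $B$ be bounded linear operators on $\mathcal{H}$. Suppose that: (i) any $f\in\mathcal{H}$ is recovered from the samples $\{\langle A^n f,g\rangle\}_{n\ge 0}$ in a stable way, and there exist constants $\lambda,\mu,\nu\ge 0$ such that for all $l\in\mathbb{Z}^+$ and all scalars $a_0,\dots,a_l$, $$\Big\|\sum_{n=0}^{l}a_n(A^* )^n(g-h)\Big\|^2+\Big\|\sum_{n=0}^{l}a_n\big((A^* )^n-(B^* )^n\big)h\Big\|^2\le \lambda\Big\|\sum_{n=0}^{l}a_n(A^* )^n g\Big\|^2+\mu\Big\|\sum_{n=0}^{l}a_n(A^* )^n g\Big\|\,\Big\|\sum_{n=0}^{l}a_n(B^* )^n h\Big\|+\nu\Big\|\sum_{n=0}^{l}a_n(B^* )^n h\Big\|^2;$$ (ii) for some real $\epsilon>0$, these same $\lambda,\mu,\nu$ satisfy both $$2(1-3\nu)\epsilon-3\mu>0\quad\text{and}\quad \max\Big\{2\lambda+\mu\epsilon,\ \frac{\mu}{\epsilon}+2\nu\Big\}<1.$$ Then any $f\in\mathcal{H}$ can also be recovered from the samples $\{\langle B^n f,h\rangle\}_{n\ge 0}$ in a stable way.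
   Context: $\mathbb{Z}^+=\{0,1,2,\dots\}$, and $A^*,B^*$ denote the Hilbert-space adjoints of $A,B$. For a bounded linear operator $C$ on $\mathcal{H}$ and a vector $u\in\mathcal{H}$, "any $f\in\mathcal{H}$ is (can be) recovered from the samples $\{\langle C^n f,u\rangle\}_{n\ge 0}$ in a stable way" means: for every $f\in\mathcal{H}$ the sequence $\{\langle C^n f,u\rangle\}_{n\ge0}$ belongs to $\ell^2(\mathbb{Z}^+)$, and there exists a bounded linear operator $\mathscr{R}:\ell^2(\mathbb{Z}^+)\to\mathcal{H}$ such that $\mathscr{R}(\{\langle C^n f,u\rangle\}_{n\ge0})=f$ for all $f\in\mathcal{H}$. *)

theory Defs
  imports "HOL-Analysis.Analysis"
begin

text \<open>
  The scalar field of a Hilbert space is the reals or the complex numbers. The class below has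
  (up to isomorphism) exactly these two models: from \<open>x * scalar_cnj x = \<bar>x\<bar>\<^sup>2\<close> and the same
  equation for \<open>1 + x\<close>, every \<open>x\<close> is a root of a monic real polynomial of degree 2, and a
  commutative field extension of the reals with that property is the reals or the complex numbers.
  On the reals \<open>scalar_cnj\<close> is forced to be the identity, on the complex numbers to be \<open>cnj\<close>.
\<close>

class hilbert_scalar = real_normed_field + complete_space +
  fixes scalar_cnj :: "'a \<Rightarrow> 'a"
  assumes scalar_cnj_add: "scalar_cnj (x + y) = scalar_cnj x + scalar_cnj y"
    and scalar_cnj_mult: "scalar_cnj (x * y) = scalar_cnj x * scalar_cnj y"
    and scalar_cnj_scalar_cnj: "scalar_cnj (scalar_cnj x) = x"
    and mult_scalar_cnj: "x * scalar_cnj x = scaleR ((norm x)\<^sup>2) 1"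

instantiation real :: hilbert_scalar
begin
definition scalar_cnj_real :: "real \<Rightarrow> real" where "scalar_cnj_real x = x"
instance
  by standard (simp_all add: scalar_cnj_real_def power2_eq_square)
end

instantiation complex :: hilbert_scalar
begin
definition scalar_cnj_complex :: "complex \<Rightarrow> complex" where "scalar_cnj_complex x = cnj x"
instance
proof
  show "x * scalar_cnj x = (norm x)\<^sup>2 *\<^sub>R 1" for x :: complex
    by (simp add: scalar_cnj_complex_def scaleR_conv_of_real complex_norm_square del: of_real_power)
qed (simp_all add: scalar_cnj_complex_def)
end

text \<open>
  A Hilbert space over \<open>'k\<close> whose underlying Banach space is a type. The norm comes from the
  inner product by \<open>inner_self\<close> (which also makes the form positive definite), and \<open>smul_of_real\<close>
  ties the multiplication by scalars to the real vector space structure carried by the type.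
  The inner product is linear in its first argument.
\<close>

locale hilbert_space = vector_space smul
  for smul :: "'k::hilbert_scalar \<Rightarrow> 'h::banach \<Rightarrow> 'h" +
  fixes ip :: "'h \<Rightarrow> 'h \<Rightarrow> 'k"
  assumes smul_of_real: "smul (of_real r) x = r *\<^sub>R x"
    and inner_add_left: "ip (x + y) z = ip x z + ip y z"
    and inner_smul_left: "ip (smul a x) y = a * ip x y"
    and inner_cnj_commute: "ip x y = scalar_cnj (ip y x)"
    and inner_self: "ip x x = of_real ((norm x)\<^sup>2)"

lemma hilbert_space_real_inner:
  "hilbert_space scaleR (inner :: 'h::{real_inner, banach} \<Rightarrow> 'h \<Rightarrow> real)"
  by standard
     (simp_all add: algebra_simps scalar_cnj_real_def inner_commute power2_norm_eq_inner)

lemma hilbert_space_complex: "hilbert_space (*) (\<lambda>x y :: complex. x * cnj y)"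
proof
  show "x * cnj x = of_real ((norm x)\<^sup>2)" for x :: complex
    by (simp only: complex_norm_square)
qed (simp_all add: algebra_simps scalar_cnj_complex_def scaleR_conv_of_real)

text \<open>\<open>bounded_linear\<close> only gives linearity over the reals, hence the second conjunct.\<close>

definition hilbert_op :: "('k::hilbert_scalar \<Rightarrow> 'h::banach \<Rightarrow> 'h) \<Rightarrow> ('h \<Rightarrow> 'h) \<Rightarrow> bool" where
  "hilbert_op smul A \<longleftrightarrow> bounded_linear A \<and> (\<forall>a x. A (smul a x) = smul a (A x))"

text \<open>For a bounded linear operator on a Hilbert space, the description is unique by definiteness
  of the inner product and denotes by the Riesz representation theorem.\<close>

definition hilbert_adj :: "('h::banach \<Rightarrow> 'h \<Rightarrow> 'k::hilbert_scalar) \<Rightarrow> ('h \<Rightarrow> 'h) \<Rightarrow> 'h \<Rightarrow> 'h" where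
  "hilbert_adj ip A = (THE A'. \<forall>x y. ip (A x) y = ip x (A' y))"

definition ell2 :: "(nat \<Rightarrow> 'k::real_normed_field) set" where
  "ell2 = {c. summable (\<lambda>n. (norm (c n))\<^sup>2)}"

definition ell2_norm :: "(nat \<Rightarrow> 'k::real_normed_field) \<Rightarrow> real" where
  "ell2_norm c = sqrt (\<Sum>n. (norm (c n))\<^sup>2)"

text \<open>Only the values on \<open>ell2\<close> matter in the following notion.\<close>

definition ell2_bounded_op ::
    "('k::hilbert_scalar \<Rightarrow> 'h::banach \<Rightarrow> 'h) \<Rightarrow> ((nat \<Rightarrow> 'k) \<Rightarrow> 'h) \<Rightarrow> bool" where
  "ell2_bounded_op smul R \<longleftrightarrow>
     (\<forall>c\<in>ell2. \<forall>d\<in>ell2. R (\<lambda>n. c n + d n) = R c + R d) \<and>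
     (\<forall>a. \<forall>c\<in>ell2. R (\<lambda>n. a * c n) = smul a (R c)) \<and>
     (\<exists>K. \<forall>c\<in>ell2. norm (R c) \<le> K * ell2_norm c)"

definition samples :: "('h \<Rightarrow> 'h \<Rightarrow> 'k) \<Rightarrow> ('h \<Rightarrow> 'h) \<Rightarrow> 'h \<Rightarrow> 'h \<Rightarrow> nat \<Rightarrow> 'k" where
  "samples ip C u f = (\<lambda>n. ip ((C ^^ n) f) u)"

definition stably_recoverable ::
    "('k::hilbert_scalar \<Rightarrow> 'h::banach \<Rightarrow> 'h) \<Rightarrow> ('h \<Rightarrow> 'h \<Rightarrow> 'k) \<Rightarrow> ('h \<Rightarrow> 'h) \<Rightarrow> 'h \<Rightarrow> bool" where
  "stably_recoverable smul ip C u \<longleftrightarrow>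
     (\<forall>f. samples ip C u f \<in> ell2) \<and>
     (\<exists>R. ell2_bounded_op smul R \<and> (\<forall>f. R (samples ip C u f) = f))"

end

theory Submission
  imports Defs
begin

text \<open>
  Put \<open>g\<^sub>n = (A\<^sup>*)\<^sup>n g\<close> and \<open>h\<^sub>n = (B\<^sup>*)\<^sup>n h\<close>. Stable recovery says that the analysis operator
  \<open>f \<mapsto> (\<langle>f, g\<^sub>n\<rangle>)\<^sub>n\<close> maps into \<open>\<ell>\<^sup>2\<close> and has a bounded left inverse \<open>R\<close>. With \<open>2uv \<le> \<epsilon>u\<^sup>2 + v\<^sup>2/\<epsilon>\<close>
  the hypotheses give \<open>\<parallel>\<Sum> a\<^sub>n (g\<^sub>n - h\<^sub>n)\<parallel>\<^sup>2 \<le> \<alpha> \<parallel>\<Sum> a\<^sub>n g\<^sub>n\<parallel>\<^sup>2 + \<beta> \<parallel>\<Sum> a\<^sub>n h\<^sub>n\<parallel>\<^sup>2\<close> for some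
  \<open>\<alpha>, \<beta> < 1\<close>, so \<open>(h\<^sub>n)\<close> inherits the Bessel property. Taking \<open>a = R\<^sup>* f\<close>, for which
  \<open>\<Sum> a\<^sub>n g\<^sub>n = f\<close>, and expanding the square shows that \<open>M f = R (\<langle>f, h\<^sub>n\<rangle>)\<^sub>n\<close> satisfies
  \<open>(1 - \<alpha>) \<parallel>f\<parallel>\<^sup>2 \<le> 2 Re \<langle>M f, f\<rangle>\<close>. A coercive operator is invertible, and \<open>M\<^sup>-\<^sup>1 R\<close> recovers \<open>f\<close>
  from its samples against \<open>h\<^sub>n\<close>.
\<close>

section \<open>Scalars: conjugation and real part\<close>

lemma scalar_cnj_1 [simp]: "scalar_cnj (1::'k::hilbert_scalar) = 1"
  using mult_scalar_cnj[of "1::'k"] by simp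

lemma scalar_cnj_0 [simp]: "scalar_cnj (0::'k::hilbert_scalar) = 0"
  using scalar_cnj_add[of "0::'k" 0] by simp

lemma norm_scalar_cnj [simp]: "norm (scalar_cnj x) = norm (x::'k::hilbert_scalar)"
proof -
  have "scaleR ((norm (scalar_cnj x))\<^sup>2) (1::'k) = scaleR ((norm x)\<^sup>2) 1"
    using mult_scalar_cnj[of x] mult_scalar_cnj[of "scalar_cnj x"]
    by (simp add: scalar_cnj_scalar_cnj mult.commute)
  then show ?thesis by simp
qed

text \<open>Polarisation, |1 + x|^2 = 1 + 2 Re x + |x|^2, extracts the real part from the norm,
  uniformly for real and complex scalars.\<close>

definition re_part :: "'k::hilbert_scalar \<Rightarrow> real" where
  "re_part x = ((norm (1 + x))\<^sup>2 - 1 - (norm x)\<^sup>2) / 2"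

lemma of_real_re_part: "of_real (2 * re_part x) = x + scalar_cnj (x::'k::hilbert_scalar)"
proof -
  have "(of_real ((norm (1 + x))\<^sup>2) :: 'k) = (1 + x) * scalar_cnj (1 + x)"
    unfolding of_real_def by (rule mult_scalar_cnj[symmetric])
  also have "\<dots> = 1 + (x + scalar_cnj x) + of_real ((norm x)\<^sup>2)"
    unfolding of_real_def mult_scalar_cnj[symmetric] by (simp add: scalar_cnj_add algebra_simps)
  finally have "(of_real ((norm (1 + x))\<^sup>2 - 1 - (norm x)\<^sup>2) :: 'k) = x + scalar_cnj x"
    by (simp add: algebra_simps)
  moreover have "2 * re_part x = (norm (1 + x))\<^sup>2 - 1 - (norm x)\<^sup>2" by (simp add: re_part_def)
  ultimately show ?thesis by simp
qed

text \<open>Real scalars embed injectively, so \<open>x + scalar_cnj x\<close> determines the real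
  part; additivity and homogeneity of \<open>re_part\<close> are checked through it.\<close>

lemma re_part_eqI: "of_real (2 * r) = x + scalar_cnj (x::'k::hilbert_scalar) \<Longrightarrow> re_part x = r"
  using of_real_re_part[of x] by (metis mult_left_cancel of_real_eq_iff zero_neq_numeral)

lemma re_part_add: "re_part (x + y) = re_part x + re_part (y::'k::hilbert_scalar)"
proof (rule re_part_eqI)
  have "of_real (2 * (re_part x + re_part y)) = (of_real (2 * re_part x) + of_real (2 * re_part y) :: 'k)"
    by (simp only: distrib_left of_real_add)
  then show "of_real (2 * (re_part x + re_part y)) = x + y + scalar_cnj (x + y)"
    unfolding of_real_re_part scalar_cnj_add by simp
qed

lemma re_part_of_real [simp]: "re_part (of_real r :: 'k::hilbert_scalar) = r"
proof -
  have "(norm (1 + of_real r :: 'k))\<^sup>2 = (1 + r)\<^sup>2"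
    by (metis norm_of_real of_real_1 of_real_add power2_abs)
  then show ?thesis by (simp add: re_part_def power2_eq_square algebra_simps)
qed

lemma scalar_cnj_of_real [simp]: "scalar_cnj (of_real r) = (of_real r :: 'k::hilbert_scalar)"
  using of_real_re_part[of "of_real r :: 'k"] by simp

lemma re_part_scalar_cnj [simp]: "re_part (scalar_cnj x) = re_part (x::'k::hilbert_scalar)"
  by (rule re_part_eqI) (simp only: of_real_re_part scalar_cnj_scalar_cnj add.commute)

lemma re_part_of_real_mult: "re_part (of_real r * x) = r * re_part (x::'k::hilbert_scalar)"
proof (rule re_part_eqI)
  have "of_real (2 * (r * re_part x)) = (of_real r * of_real (2 * re_part x) :: 'k)"
    by (simp add: mult.left_commute)
  then show "of_real (2 * (r * re_part x)) = of_real r * x + scalar_cnj (of_real r * x)"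
    unfolding of_real_re_part by (simp add: scalar_cnj_mult algebra_simps)
qed

lemma abs_re_part_le: "\<bar>re_part x\<bar> \<le> norm (x::'k::hilbert_scalar)"
proof -
  have "\<bar>2 * re_part x\<bar> = norm (x + scalar_cnj x)"
    unfolding of_real_re_part[symmetric] by (rule norm_of_real[symmetric])
  also have "\<dots> \<le> norm x + norm x"
    using norm_triangle_ineq[of x "scalar_cnj x"] by simp
  finally show ?thesis by simp
qed

lemma bounded_linear_re_part: "bounded_linear (re_part :: 'k::hilbert_scalar \<Rightarrow> real)"
  by (rule bounded_linear_intro[where K = 1])
     (simp_all add: re_part_add re_part_of_real_mult scaleR_conv_of_real abs_re_part_le)

text \<open>Baire category: the closed sublevel sets \<open>T k\<close> cover the space, so one of
  them contains a ball, and rescaling turns the bound on that ball into a multiple of the norm. The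
  intended seminorms are the Euclidean norms of the first coefficients of an analysis
  operator.\<close>

lemma uniform_boundedness_seminorms:
  fixes p :: "nat \<Rightarrow> 'h::banach \<Rightarrow> real"
  assumes cont: "\<And>n. continuous_on UNIV (p n)"
    and diff: "\<And>n x y. p n (x - y) \<le> p n x + p n y"
    and scale: "\<And>n r x. p n (r *\<^sub>R x) = \<bar>r\<bar> * p n x"
    and bounded: "\<And>x. \<exists>k. \<forall>n. p n x \<le> k"
  obtains D where "D \<ge> 0" "\<And>n x. p n x \<le> D * norm x"
proof -
  define T where "T k = {x. \<forall>n. p n x \<le> real k}" for k :: nat
  have closed: "closed (T k)" for k
    unfolding T_def using cont
    by (intro closed_Collect_all closed_Collect_le continuous_on_const) auto
  have cover: "\<Union>(range T) = UNIV"
  proof -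
    have "\<exists>k. x \<in> T k" for x
    proof -
      obtain K where "\<And>n. p n x \<le> K" using bounded by blast
      moreover obtain k :: nat where "K \<le> real k" using real_arch_simple by blast
      ultimately have "x \<in> T k" unfolding T_def by (auto intro: order_trans)
      then show ?thesis ..
    qed
    then show ?thesis by auto
  qed
  have "\<exists>k. interior (T k) \<noteq> {}"
  proof (rule ccontr)
    assume "\<not> ?thesis"
    then have "(euclidean :: 'h topology) interior_of \<Union>(range T) = {}"
      using closed completely_metrizable_space_euclidean
      by (intro Baire_category_alt) (auto simp: interior_of_subset)
    then show False by (simp add: cover)
  qed
  then obtain k x0 where "x0 \<in> interior (T k)" by blast
  then obtain r where r: "r > 0" "ball x0 r \<subseteq> T k" by (auto simp: mem_interior)
  \<comment> \<open>\<open>y\<close> is the difference of \<open>x0 + y\<close> and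
    \<open>x0\<close>, both in \<open>T k\<close>; hence the factor 2.\<close>
  have ball: "p n y \<le> 2 * real k" if "norm y < r" for n y
  proof -
    have "x0 + y \<in> T k" "x0 \<in> T k" using r that by (auto simp: dist_norm)
    then show ?thesis using diff[of n "x0 + y" x0] by (auto simp: T_def dest!: spec[where x = n])
  qed
  have "p n x \<le> (4 * real k / r) * norm x" for n x
  proof (cases "x = 0")
    case True
    then show ?thesis using scale[of n 0 0] by simp
  next
    case False
    \<comment> \<open>Rescaling \<open>x\<close> to norm r/2 puts it into the ball and produces the
      constant 4k/r.\<close>
    have "norm ((r / (2 * norm x)) *\<^sub>R x) < r" using False r by simp
    from ball[OF this, of n] have "r / (2 * norm x) * p n x \<le> 2 * real k"
      using r by (simp add: scale)
    then show ?thesis using False r by (simp add: field_simps)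
  qed
  then show thesis using r by (intro that[of "4 * real k / r"]) auto
qed

section \<open>Inner product geometry, Riesz representation, adjoints and coercive operators\<close>

context hilbert_space
begin

lemma inner_add_right: "ip x (y + z) = ip x y + ip x z"
  by (metis inner_add_left inner_cnj_commute scalar_cnj_add)

lemma inner_smul_right: "ip x (smul a y) = scalar_cnj a * ip x y"
  by (metis inner_smul_left inner_cnj_commute scalar_cnj_mult)

lemma inner_zero_left [simp]: "ip 0 x = 0"
  using inner_add_left[of 0 0 x] by simp

lemma inner_zero_right [simp]: "ip x 0 = 0"
  using inner_add_right[of x 0 0] by simp

lemma inner_diff_left: "ip (x - y) z = ip x z - ip y z"
  using inner_add_left[of "x - y" y z] by simp

lemma inner_diff_right: "ip x (y - z) = ip x y - ip x z"
  using inner_add_right[of x "y - z" z] by simp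

lemma inner_sum_left: "ip (\<Sum>i\<in>F. f i) z = (\<Sum>i\<in>F. ip (f i) z)"
  by (induction F rule: infinite_finite_induct) (simp_all add: inner_add_left)

lemma inner_sum_right: "ip z (\<Sum>i\<in>F. f i) = (\<Sum>i\<in>F. ip z (f i))"
  by (induction F rule: infinite_finite_induct) (simp_all add: inner_add_right)

lemma inner_scaleR_left: "ip (r *\<^sub>R x) y = of_real r * ip x y"
  by (metis smul_of_real inner_smul_left)

lemma inner_scaleR_right: "ip x (r *\<^sub>R y) = of_real r * ip x y"
  by (metis smul_of_real inner_smul_right scalar_cnj_of_real)

lemma norm_inner_commute: "norm (ip x y) = norm (ip y x)"
  by (metis inner_cnj_commute norm_scalar_cnj)

lemma re_inner_commute: "re_part (ip x y) = re_part (ip y x)"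
  by (metis inner_cnj_commute re_part_scalar_cnj)

lemma re_inner_self [simp]: "re_part (ip x x) = (norm x)\<^sup>2"
  by (simp only: inner_self re_part_of_real)

lemma norm_add_sq: "(norm (x + y))\<^sup>2 = (norm x)\<^sup>2 + 2 * re_part (ip x y) + (norm y)\<^sup>2"
proof -
  have "(norm (x + y))\<^sup>2 = re_part (ip (x + y) (x + y))" by simp
  also have "\<dots> = re_part (ip x x) + (re_part (ip x y) + re_part (ip y x)) + re_part (ip y y)"
    by (simp only: inner_add_left inner_add_right re_part_add)
  finally show ?thesis by (simp add: re_inner_commute[of y x])
qed

lemma norm_diff_sq: "(norm (x - y))\<^sup>2 = (norm x)\<^sup>2 - 2 * re_part (ip x y) + (norm y)\<^sup>2"
  using norm_add_sq[of "x - y" y] 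
  by (simp add: inner_diff_left linear_diff[OF bounded_linear.linear[OF bounded_linear_re_part]])

text \<open>The norm of the type is homogeneous for real scaling; for scalars in \<open>'k\<close>
  homogeneity comes from the inner product, where \<open>a\<close> leaves both arguments as
  \<open>a * scalar_cnj a\<close>.\<close>

lemma norm_smul: "norm (smul a x) = norm a * norm x"
proof -
  have "of_real ((norm (smul a x))\<^sup>2) = (a * scalar_cnj a) * ip x x"
    by (simp only: inner_self[symmetric] inner_smul_left inner_smul_right mult_ac)
  also have "\<dots> = of_real ((norm a * norm x)\<^sup>2)"
    unfolding mult_scalar_cnj inner_self
    by (simp add: scaleR_conv_of_real power_mult_distrib)
  finally have "(norm (smul a x))\<^sup>2 = (norm a * norm x)\<^sup>2"
    by (simp only: of_real_eq_iff)
  then show ?thesis by simp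
qed

text \<open>The triangle inequality of the given norm, squared, bounds the real part of the inner
  product. Multiplying \<open>x\<close> by the conjugate of \<open>ip x y\<close> turns that real
  part into |ip x y|^2, and one factor cancels.\<close>

lemma Cauchy_Schwarz: "norm (ip x y) \<le> norm x * norm y"
proof (cases "ip x y = 0")
  case False
  define a where "a = scalar_cnj (ip x y)"
  have re: "re_part (ip (smul a x) y) = (norm (ip x y))\<^sup>2"
    using mult_scalar_cnj[of "ip x y"]
    by (simp add: a_def inner_smul_left mult.commute flip: of_real_def del: of_real_power)
  have real_CS: "re_part (ip u v) \<le> norm u * norm v" for u v
  proof -
    have "(norm (u + v))\<^sup>2 \<le> (norm u + norm v)\<^sup>2"
      by (intro power_mono norm_triangle_ineq) simp
    then show ?thesis by (simp add: norm_add_sq power2_sum)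
  qed
  have "(norm (ip x y))\<^sup>2 \<le> norm (ip x y) * (norm x * norm y)"
    using real_CS[of "smul a x" y] unfolding re norm_smul by (simp add: a_def mult.assoc)
  then show ?thesis using False by (simp add: power2_eq_square)
qed simp

lemma bounded_linear_inner_left: "bounded_linear (\<lambda>x. ip x y)"
  by (rule bounded_linear_intro[where K = "norm y"])
     (simp_all add: inner_add_left inner_scaleR_left scaleR_conv_of_real Cauchy_Schwarz)

lemma bounded_linear_inner_right: "bounded_linear (ip x)"
  by (rule bounded_linear_intro[where K = "norm x"])
     (simp_all add: inner_add_right inner_scaleR_right scaleR_conv_of_real
       Cauchy_Schwarz[THEN order_trans] mult.commute)

lemma inner_eq_imp_eq:
  assumes "\<And>x. ip x y = ip x z"
  shows "y = z"
proof -
  have "ip (y - z) (y - z) = of_real 0" by (simp add: inner_diff_right assms)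
  then have "(norm (y - z))\<^sup>2 = 0" by (metis re_inner_self re_part_of_real)
  then show ?thesis by simp
qed

text \<open>The representing vector minimises \<open>\<parallel>x\<parallel>\<^sup>2 / 2 - Re (\<phi> x)\<close>; the parallelogram identity
  makes every minimising sequence Cauchy.\<close>

lemma Riesz_representation:
  assumes "bounded_linear \<phi>" and smul: "\<And>a x. \<phi> (smul a x) = a * \<phi> x"
  obtains z where "\<And>x. \<phi> x = ip x z"
proof -
  define \<psi> where "\<psi> x = re_part (\<phi> x)" for x
  have bl: "bounded_linear \<psi>"
    unfolding \<psi>_def by (rule bounded_linear_compose[OF bounded_linear_re_part assms(1)])
  then interpret \<psi>: bounded_linear \<psi> .
  define J where "J x = (norm x)\<^sup>2 / 2 - \<psi> x" for x
  obtain K where K: "\<And>x. norm (\<psi> x) \<le> norm x * K" using \<psi>.bounded by blast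
  have J_bound: "J x \<ge> - K\<^sup>2 / 2" for x
  proof -
    have "\<psi> x \<le> norm x * K" using K[of x] by simp
    moreover have "0 \<le> (norm x - K)\<^sup>2" by simp
    ultimately show ?thesis by (simp add: J_def power2_diff) 
  qed
  define m where "m = Inf (range J)"
  have bdd: "bdd_below (range J)" by (rule bdd_belowI2[OF J_bound])
  have m_le: "m \<le> J x" for x unfolding m_def using bdd by (simp add: cINF_lower)
  have "\<exists>x. J x < m + 1 / real (Suc n)" for n
  proof -
    have "m < m + 1 / real (Suc n)" by simp
    then show ?thesis unfolding m_def using cInf_lessD[of "range J"] by blast
  qed
  then obtain X where X: "\<And>n. J (X n) < m + 1 / real (Suc n)" by metis
  have par: "(norm (x - y))\<^sup>2 \<le> 4 * (J x - m) + 4 * (J y - m)" for x y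
  proof -
    have "m \<le> J ((1/2) *\<^sub>R (x + y))" by (rule m_le)
    also have "\<dots> = (norm (x + y))\<^sup>2 / 8 - \<psi> x / 2 - \<psi> y / 2"
      unfolding J_def \<psi>.scaleR \<psi>.add norm_scaleR by (simp add: power_divide add_divide_distrib)
    finally show ?thesis
      unfolding J_def norm_diff_sq norm_add_sq by (simp add: add_divide_distrib)
  qed
  have "Cauchy X"
  proof (rule CauchyI)
    fix e :: real assume "e > 0"
    \<comment> \<open>Since \<open>J (X k) - m < 1 / Suc k\<close>, this choice keeps each of the
      two terms on the right of \<open>par\<close> below e^2/2.\<close>
    then obtain M :: nat where M: "8 / e\<^sup>2 < real M" using reals_Archimedean2 by blast
    have "norm (X i - X j) < e" if "i \<ge> M" "j \<ge> M" for i j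
    proof -
      have small: "4 * (J (X k) - m) < e\<^sup>2 / 2" if "k \<ge> M" for k
      proof -
        have "8 / e\<^sup>2 < real (Suc k)" using M that by simp
        then have "8 < e\<^sup>2 * real (Suc k)" using \<open>e > 0\<close> by (simp add: field_simps)
        then have "1 / real (Suc k) < e\<^sup>2 / 8" by (simp add: field_simps)
        then show ?thesis using X[of k] by simp
      qed
      have "(norm (X i - X j))\<^sup>2 < e\<^sup>2"
        using par[of "X i" "X j"] small[OF that(1)] small[OF that(2)] by simp
      then show ?thesis using \<open>e > 0\<close> by (simp add: power2_less_imp_less)
    qed
    then show "\<exists>M. \<forall>i\<ge>M. \<forall>j\<ge>M. norm (X i - X j) < e" by blast
  qed
  then obtain z where z: "X \<longlonglongrightarrow> z" by (auto simp: Cauchy_convergent_iff convergent_def)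
  have Jz: "J z \<le> m"
  proof -
    have "(\<lambda>n. J (X n)) \<longlonglongrightarrow> J z"
      unfolding J_def by (intro tendsto_intros z \<psi>.tendsto) simp
    moreover have "(\<lambda>n. m + 1 / real (Suc n)) \<longlonglongrightarrow> m + 0"
      by (intro tendsto_intros LIMSEQ_Suc[OF lim_1_over_n])
    ultimately show ?thesis using X by (intro LIMSEQ_le[of _ _ _ m]) (auto intro: less_imp_le)
  qed
  have re: "re_part (\<phi> x) = re_part (ip x z)" for x
  proof -
    \<comment> \<open>\<open>d\<close> is the derivative of \<open>J (z + t *\<^sub>R x)\<close> at
      t = 0, which vanishes at a minimiser.\<close>
    define d where "d = re_part (ip z x) - \<psi> x"
    have *: "0 \<le> t * d + t\<^sup>2 * (norm x)\<^sup>2 / 2" for t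
    proof -
      have "J z \<le> J (z + t *\<^sub>R x)" using Jz m_le order_trans by blast
      then show ?thesis
        unfolding J_def norm_add_sq d_def inner_scaleR_right re_part_of_real_mult \<psi>.add \<psi>.scaleR
        by (simp add: algebra_simps power_mult_distrib)
    qed
    have "d = 0"
    proof (rule ccontr)
      assume "d \<noteq> 0"
      \<comment> \<open>With t = -s d the linear term dominates the quadratic one, as
        \<open>s * (norm x)\<^sup>2 < 1\<close>; the summand 1 covers \<open>x = 0\<close>.\<close>
      define s where "s = 1 / (1 + (norm x)\<^sup>2)"
      have s: "s > 0" "s * (norm x)\<^sup>2 < 1"
        by (simp_all add: s_def add_pos_nonneg field_simps)
      have "0 \<le> - (s * d\<^sup>2) + s * d\<^sup>2 * (s * (norm x)\<^sup>2) / 2"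
        using *[of "- (s * d)"] by (simp add: power2_eq_square algebra_simps)
      also have "\<dots> = s * d\<^sup>2 * (s * (norm x)\<^sup>2 / 2 - 1)" by (simp add: algebra_simps)
      also have "\<dots> < 0" using s \<open>d \<noteq> 0\<close> by (intro mult_pos_neg) auto
      finally show False by simp
    qed
    then show ?thesis by (simp add: d_def \<psi>_def re_inner_commute)
  qed
  have "\<phi> x = ip x z" for x
  proof -
    \<comment> \<open>Equality of real parts extends to equality of scalars: applied to
      \<open>smul (scalar_cnj d) x\<close> it says |d|^2 = 0.\<close>
    define d where "d = \<phi> x - ip x z"
    have "re_part (scalar_cnj d * d) = 0"
      using re[of "smul (scalar_cnj d) x"]
      by (simp add: d_def smul inner_smul_left right_diff_distrib
          linear_diff[OF bounded_linear.linear[OF bounded_linear_re_part]])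
    moreover have "scalar_cnj d * d = of_real ((norm d)\<^sup>2)"
      using mult_scalar_cnj[of d] by (simp add: of_real_def mult.commute)
    ultimately have "(norm d)\<^sup>2 = 0" by (metis re_part_of_real)
    then show ?thesis by (simp add: d_def)
  qed
  then show thesis by (rule that)
qed

text \<open>Riesz gives a representing vector for each \<open>y\<close>, and
  \<open>inner_eq_imp_eq\<close> makes the resulting map unique, so the description in
  \<open>hilbert_adj\<close> denotes.\<close>

lemma inner_hilbert_adj:
  assumes "hilbert_op smul A"
  shows "ip (A x) y = ip x (hilbert_adj ip A y)"
proof -
  have bl: "bounded_linear A" and smul: "\<And>a x. A (smul a x) = smul a (A x)"
    using assms by (auto simp: hilbert_op_def)
  have "\<exists>z. \<forall>x. ip (A x) y = ip x z" for y
  proof (rule Riesz_representation[of "\<lambda>x. ip (A x) y"])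
    show "bounded_linear (\<lambda>x. ip (A x) y)"
      by (rule bounded_linear_compose[OF bounded_linear_inner_left bl])
  qed (auto simp: smul inner_smul_left)
  then obtain A' where A': "\<forall>x y. ip (A x) y = ip x (A' y)" by metis
  moreover have "B = A'" if "\<forall>x y. ip (A x) y = ip x (B y)" for B
    using that A' by (intro ext inner_eq_imp_eq) metis
  ultimately have "\<forall>x y. ip (A x) y = ip x (hilbert_adj ip A y)"
    unfolding hilbert_adj_def by (rule theI)
  then show ?thesis by blast
qed

text \<open>Moving the powers of the operator to the fixed vector turns samples into an analysis
  operator, so recovery becomes a question about a sequence of vectors.\<close>

lemma samples_eq:
  assumes "hilbert_op smul A"
  shows "samples ip A u f = (\<lambda>n. ip f ((hilbert_adj ip A ^^ n) u))"
proof
  show "samples ip A u f n = ip f ((hilbert_adj ip A ^^ n) u)" for n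
    unfolding samples_def
    by (induction n arbitrary: f) (simp_all add: funpow_swap1 inner_hilbert_adj[OF assms])
qed

text \<open>The lower bound is Cauchy-Schwarz and gives injectivity. For surjectivity,
  \<open>M x = y\<close> is read as a fixed point equation for x - \<tau>(M x - y), a contraction
  for suitable \<tau>.\<close>

lemma coercive_bij:
  assumes "bounded_linear M" "c > 0"
    and coercive: "\<And>x. c * (norm x)\<^sup>2 \<le> re_part (ip (M x) x)"
  shows "bij M" and "\<And>x. c * norm x \<le> norm (M x)"
proof -
  interpret M: bounded_linear M by fact
  show lower: "c * norm x \<le> norm (M x)" for x
  proof (cases "x = 0")
    case False
    have "c * (norm x)\<^sup>2 \<le> norm (M x) * norm x"
      using coercive[of x] abs_re_part_le[of "ip (M x) x"] Cauchy_Schwarz[of "M x" x] by linarith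
    then show ?thesis using False by (simp add: power2_eq_square)
  qed simp
  have "inj M"
  proof (rule injI)
    fix x y assume "M x = M y"
    then show "x = y" using lower[of "x - y"] \<open>c > 0\<close> by (simp add: M.diff mult_le_0_iff)
  qed
  moreover have "surj M"
  proof -
    obtain K0 where K0: "\<And>x. norm (M x) \<le> norm x * K0" using M.bounded by blast
    \<comment> \<open>The maximum ensures \<open>K > 0\<close> and \<open>c \<le> K\<close>, so that
      the square root defining \<open>q\<close> is taken of a nonnegative number.\<close>
    define K where "K = max K0 c"
    have "K > 0" "c \<le> K" using \<open>c > 0\<close> by (auto simp: K_def)
    have K: "norm (M x) \<le> norm x * K" for x
      using K0[of x] by (rule order_trans) (simp add: K_def mult_left_mono)
    \<comment> \<open>This \<tau> minimises 1 - 2\<tau>c + \<tau>^2 K^2, the factor by which the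
      squared norm grows at most; the minimum is \<open>q\<^sup>2\<close>.\<close>
    define \<tau> where "\<tau> = c / K\<^sup>2"
    define q where "q = sqrt (1 - c\<^sup>2 / K\<^sup>2)"
    have "c\<^sup>2 / K\<^sup>2 \<le> 1" using \<open>c > 0\<close> \<open>c \<le> K\<close> \<open>K > 0\<close> by (simp add: power_mono)
    then have q: "0 \<le> q" "q < 1" "q\<^sup>2 = 1 - c\<^sup>2 / K\<^sup>2"
      using \<open>c > 0\<close> \<open>K > 0\<close> by (simp_all add: q_def)
    have contr: "norm (d - \<tau> *\<^sub>R M d) \<le> q * norm d" for d
    proof (rule power2_le_imp_le)
      have "(norm (d - \<tau> *\<^sub>R M d))\<^sup>2
          = (norm d)\<^sup>2 - 2 * \<tau> * re_part (ip (M d) d) + \<tau>\<^sup>2 * (norm (M d))\<^sup>2"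
        by (simp add: norm_diff_sq inner_scaleR_right re_part_of_real_mult
            re_inner_commute[of d] power_mult_distrib)
      also have "\<dots> \<le> (norm d)\<^sup>2 - 2 * \<tau> * (c * (norm d)\<^sup>2) + \<tau>\<^sup>2 * (norm d * K)\<^sup>2"
        using \<open>c > 0\<close> \<open>K > 0\<close>
        by (intro add_mono diff_mono mult_left_mono coercive power_mono K) (auto simp: \<tau>_def)
      also have "\<dots> = (q * norm d)\<^sup>2"
        using \<open>K > 0\<close> unfolding power_mult_distrib q \<tau>_def
        by (simp add: field_simps power2_eq_square)
      finally show "(norm (d - \<tau> *\<^sub>R M d))\<^sup>2 \<le> (q * norm d)\<^sup>2" .
    qed (use q in auto)
    have "\<exists>x. y = M x" for y
    proof -
      have "\<exists>!x. x - \<tau> *\<^sub>R (M x - y) = x"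
      proof (rule banach_fix_type[OF q(1,2)], intro allI)
        fix x x'
        have eq: "x - \<tau> *\<^sub>R (M x - y) - (x' - \<tau> *\<^sub>R (M x' - y)) = (x - x') - \<tau> *\<^sub>R M (x - x')"
          by (simp add: M.diff algebra_simps)
        show "dist (x - \<tau> *\<^sub>R (M x - y)) (x' - \<tau> *\<^sub>R (M x' - y)) \<le> q * dist x x'"
          unfolding dist_norm eq by (rule contr)
      qed
      then show ?thesis using \<open>c > 0\<close> \<open>K > 0\<close> by (auto simp: \<tau>_def)
    qed
    then show ?thesis by (auto simp: surj_def)
  qed
  ultimately show "bij M" by (rule bijI)
qed

end

section \<open>Square-summable sequences, truncation and bounded operators on them\<close>

lemma ell2_norm_nonneg: "c \<in> ell2 \<Longrightarrow> 0 \<le> ell2_norm c"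
  by (simp add: ell2_norm_def ell2_def suminf_nonneg)

lemma ell2_sum_le:
  assumes "c \<in> ell2"
  shows "(\<Sum>n<N. (norm (c n))\<^sup>2) \<le> (ell2_norm c)\<^sup>2"
proof -
  have s: "summable (\<lambda>n. (norm (c n))\<^sup>2)" using assms by (simp add: ell2_def)
  then show ?thesis
    unfolding ell2_norm_def by (simp add: suminf_nonneg sum_le_suminf)
qed

lemma ell2_boundedI:
  fixes c :: "nat \<Rightarrow> 'k::real_normed_field"
  assumes "\<And>N. (\<Sum>n<N. (norm (c n))\<^sup>2) \<le> C\<^sup>2" "C \<ge> 0"
  shows "c \<in> ell2" and "ell2_norm c \<le> C"
proof -
  have s: "summable (\<lambda>n. (norm (c n))\<^sup>2)"
  proof (rule bounded_imp_summable)
    show "(\<Sum>k\<le>n. (norm (c k))\<^sup>2) \<le> C\<^sup>2" for n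
      using assms(1)[of "Suc n"] by (simp only: lessThan_Suc_atMost)
  qed simp
  then show "c \<in> ell2" by (simp add: ell2_def)
  have "(\<Sum>n. (norm (c n))\<^sup>2) \<le> C\<^sup>2" by (rule suminf_le_const[OF s assms(1)])
  then show "ell2_norm c \<le> C"
    unfolding ell2_norm_def using assms(2) by (rule real_le_lsqrt[rotated])
qed

definition unit_seq :: "nat \<Rightarrow> nat \<Rightarrow> 'k::real_normed_field" where
  "unit_seq n m = (if m = n then 1 else 0)"

definition truncate :: "nat \<Rightarrow> (nat \<Rightarrow> 'k::real_normed_field) \<Rightarrow> nat \<Rightarrow> 'k" where
  "truncate N c n = (if n < N then c n else 0)"

lemma truncate_sums:
  "(\<lambda>n. (norm (truncate N c n))\<^sup>2) sums (\<Sum>n<N. (norm (c n))\<^sup>2)"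
  using sums_finite[of "{..<N}" "\<lambda>n. (norm (truncate N c n))\<^sup>2"]
  by (simp add: truncate_def)

lemma truncate_ell2: "truncate N c \<in> ell2"
  using truncate_sums[of N c] by (simp add: ell2_def sums_iff)

lemma ell2_norm_truncate: "ell2_norm (truncate N c) = sqrt (\<Sum>n<N. (norm (c n))\<^sup>2)"
  using truncate_sums[of N c] by (simp add: ell2_norm_def sums_iff)

lemma unit_seq_ell2: "unit_seq n \<in> ell2"
proof -
  have "(\<lambda>m. (norm (unit_seq n m :: 'a))\<^sup>2) = (\<lambda>m. if m = n then 1 else 0)"
    by (auto simp: unit_seq_def)
  then show ?thesis by (simp add: ell2_def)
qed

text \<open>Each entry is kept or removed entirely, so the squared tail norm is the full sum minus a
  partial sum.\<close>

lemma tail_ell2: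
  assumes "c \<in> ell2"
  shows "(\<lambda>n. c n - truncate N c n) \<in> ell2"
    and "(\<lambda>N. ell2_norm (\<lambda>n. c n - truncate N c n)) \<longlonglongrightarrow> 0"
proof -
  define S where "S = (\<Sum>n. (norm (c n))\<^sup>2)"
  have S: "(\<lambda>n. (norm (c n))\<^sup>2) sums S"
    unfolding S_def using assms by (simp add: ell2_def summable_sums)
  have tail: "(\<lambda>n. (norm (c n - truncate N c n))\<^sup>2) sums (S - (\<Sum>n<N. (norm (c n))\<^sup>2))" for N
  proof -
    have "(\<lambda>n. (norm (c n - truncate N c n))\<^sup>2)
        = (\<lambda>n. (norm (c n))\<^sup>2 - (norm (truncate N c n))\<^sup>2)"
      by (auto simp: truncate_def)
    then show ?thesis using sums_diff[OF S truncate_sums[of N c]] by simp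
  qed
  then show "(\<lambda>n. c n - truncate N c n) \<in> ell2" by (auto simp: ell2_def sums_iff)
  have "(\<lambda>N. sqrt (S - (\<Sum>n<N. (norm (c n))\<^sup>2))) \<longlonglongrightarrow> sqrt (S - S)"
    using S unfolding sums_def by (intro tendsto_intros)
  then show "(\<lambda>N. ell2_norm (\<lambda>n. c n - truncate N c n)) \<longlonglongrightarrow> 0"
    using tail by (simp add: ell2_norm_def sums_iff)
qed

text \<open>The hypotheses give w^2 \<le> (u + sqrt \<beta> v)^2, hence v \<le> 2u + sqrt \<beta> v,
  and the last term is absorbed because sqrt \<beta> < 1. In the application u and v are the norms
  of two finite sums and w that of their difference.\<close>

lemma norm_le_weighted_sum:
  fixes u v w \<alpha> \<beta> :: real
  assumes "v \<le> u + w" "w\<^sup>2 \<le> \<alpha> * u\<^sup>2 + \<beta> * v\<^sup>2" "0 \<le> u" "0 \<le> v"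
    "0 \<le> \<alpha>" "\<alpha> < 1" "0 \<le> \<beta>" "\<beta> < 1"
  shows "v \<le> 2 / (1 - sqrt \<beta>) * u"
proof -
  have "w\<^sup>2 \<le> \<alpha> * u\<^sup>2 + \<beta> * v\<^sup>2" by (rule assms(2))
  also have "\<dots> \<le> 1 * u\<^sup>2 + (sqrt \<beta> * v)\<^sup>2"
    unfolding power_mult_distrib using assms(5-8) by (intro add_mono mult_right_mono) auto
  also have "\<dots> \<le> (u + sqrt \<beta> * v)\<^sup>2"
    using mult_nonneg_nonneg[OF assms(3) mult_nonneg_nonneg[OF real_sqrt_ge_zero[OF assms(7)] assms(4)]]
    by (simp only: power2_sum)
  finally have "w \<le> u + sqrt \<beta> * v"
    by (rule power2_le_imp_le) (intro add_nonneg_nonneg mult_nonneg_nonneg real_sqrt_ge_zero assms)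
  then have "v * (1 - sqrt \<beta>) \<le> 2 * u" using assms(1) by (simp add: algebra_simps)
  moreover have "sqrt \<beta> < 1" using assms by simp
  ultimately show ?thesis by (simp add: field_simps)
qed

lemma ell2_bounded_op_add:
  "ell2_bounded_op smul R \<Longrightarrow> c \<in> ell2 \<Longrightarrow> d \<in> ell2 \<Longrightarrow> R (\<lambda>n. c n + d n) = R c + R d"
  by (simp add: ell2_bounded_op_def)

lemma ell2_bounded_op_mult:
  "ell2_bounded_op smul R \<Longrightarrow> c \<in> ell2 \<Longrightarrow> R (\<lambda>n. a * c n) = smul a (R c)"
  by (simp add: ell2_bounded_op_def)

lemma ell2_bounded_op_bounded:
  assumes "ell2_bounded_op smul R"
  obtains K where "K \<ge> 0" "\<And>c. c \<in> ell2 \<Longrightarrow> norm (R c) \<le> K * ell2_norm c"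
proof -
  obtain K where K: "\<And>c. c \<in> ell2 \<Longrightarrow> norm (R c) \<le> K * ell2_norm c"
    using assms unfolding ell2_bounded_op_def by blast
  have "norm (R c) \<le> max K 0 * ell2_norm c" if "c \<in> ell2" for c
  proof -
    have "K * ell2_norm c \<le> max K 0 * ell2_norm c"
      by (intro mult_right_mono ell2_norm_nonneg that) simp
    then show ?thesis using K[OF that] by simp
  qed
  then show thesis by (intro that[of "max K 0"]) auto
qed

section \<open>Series form of operators on \<open>ell2\<close>, and Bessel sequences\<close>

context hilbert_space
begin

lemma ell2_bounded_op_truncate:
  assumes "ell2_bounded_op smul R"
  shows "R (truncate N c) = (\<Sum>n<N. smul (c n) (R (unit_seq n)))"
proof (induction N)
  case 0
  have "R (\<lambda>n. 0 * unit_seq 0 n) = smul 0 (R (unit_seq 0))"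
    by (rule ell2_bounded_op_mult[OF assms unit_seq_ell2])
  moreover have "truncate 0 c = (\<lambda>n. 0)" by (auto simp: truncate_def)
  ultimately show ?case by simp
next
  case (Suc N)
  have eq: "truncate (Suc N) c = (\<lambda>n. truncate N c n + c N * unit_seq N n)"
    by (rule ext) (auto simp: truncate_def unit_seq_def less_Suc_eq)
  have "(\<lambda>n. c N * unit_seq N n) \<in> ell2"
  proof -
    have "(\<lambda>n. (norm (c N * unit_seq N n))\<^sup>2) = (\<lambda>n. if n = N then (norm (c N))\<^sup>2 else 0)"
      by (auto simp: unit_seq_def)
    then show ?thesis by (simp add: ell2_def)
  qed
  then show ?case
    unfolding eq
    by (simp add: Suc.IH ell2_bounded_op_add[OF assms truncate_ell2]
        ell2_bounded_op_mult[OF assms unit_seq_ell2])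
qed

text \<open>Truncations converge to \<open>c\<close> in the \<open>ell2\<close> norm and
  \<open>R\<close> is bounded, so \<open>R\<close> is determined by its values on unit
  sequences.\<close>

lemma ell2_bounded_op_sums:
  assumes R: "ell2_bounded_op smul R" and c: "c \<in> ell2"
  shows "(\<lambda>n. smul (c n) (R (unit_seq n))) sums R c"
proof -
  obtain K where K: "\<And>c. c \<in> ell2 \<Longrightarrow> norm (R c) \<le> K * ell2_norm c"
    using ell2_bounded_op_bounded[OF R] by blast
  define tl where "tl N = (\<lambda>n. c n - truncate N c n)" for N
  have split: "R c - R (truncate N c) = R (tl N)" for N
  proof -
    have "R (\<lambda>n. truncate N c n + tl N n) = R (truncate N c) + R (tl N)"
      unfolding tl_def by (intro ell2_bounded_op_add[OF R] truncate_ell2 tail_ell2(1)[OF c])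
    then show ?thesis by (simp add: tl_def)
  qed
  have "(\<lambda>N. R c - R (truncate N c)) \<longlonglongrightarrow> 0"
    unfolding split
  proof (rule Lim_null_comparison)
    show "\<forall>\<^sub>F N in sequentially. norm (R (tl N)) \<le> K * ell2_norm (tl N)"
      unfolding tl_def by (intro always_eventually allI K tail_ell2(1)[OF c])
    show "(\<lambda>N. K * ell2_norm (tl N)) \<longlonglongrightarrow> 0"
      unfolding tl_def by (rule tendsto_mult_right_zero[OF tail_ell2(2)[OF c]])
  qed
  then have "(\<lambda>N. R c - (R c - R (truncate N c))) \<longlonglongrightarrow> R c - 0" by (intro tendsto_intros)
  then show ?thesis by (simp add: sums_def ell2_bounded_op_truncate[OF R])
qed

lemma ell2_bounded_op_compose:
  assumes R: "ell2_bounded_op smul R"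
    and T: "bounded_linear T" "\<And>a x. T (smul a x) = smul a (T x)"
  shows "ell2_bounded_op smul (\<lambda>c. T (R c))"
proof -
  interpret T: bounded_linear T by fact
  obtain K where K: "\<And>c. c \<in> ell2 \<Longrightarrow> norm (R c) \<le> K * ell2_norm c"
    using ell2_bounded_op_bounded[OF R] by blast
  obtain L where L: "L \<ge> 0" "\<And>x. norm (T x) \<le> norm x * L" using T.nonneg_bounded by blast
  have "norm (T (R c)) \<le> (K * L) * ell2_norm c" if "c \<in> ell2" for c
    using order_trans[OF L(2) mult_right_mono[OF K[OF that] L(1)]] by (simp add: mult_ac)
  then show ?thesis
    unfolding ell2_bounded_op_def
    by (auto simp: T.add T(2) ell2_bounded_op_add[OF R] ell2_bounded_op_mult[OF R])
qed

text \<open>\<open>D\<close> bounds the norm of the analysis operator, so \<open>D\<^sup>2\<close>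
  is the usual Bessel bound. Partial sums keep summability out of the definition.\<close>

definition bessel :: "(nat \<Rightarrow> 'h) \<Rightarrow> real \<Rightarrow> bool" where
  "bessel b D \<longleftrightarrow> D \<ge> 0 \<and> (\<forall>x N. (\<Sum>n<N. (norm (ip x (b n)))\<^sup>2) \<le> (D * norm x)\<^sup>2)"

text \<open>Uniform boundedness for \<open>p N x\<close>, the Euclidean norm of the first
  \<open>N\<close> coefficients of \<open>x\<close>; pointwise it is bounded by the
  \<open>ell2\<close> norm of all of them.\<close>

lemma pointwise_ell2_imp_bessel:
  assumes "\<And>x. (\<lambda>n. ip x (b n)) \<in> ell2"
  obtains D where "bessel b D"
proof -
  define p where "p N x = L2_set (\<lambda>n. norm (ip x (b n))) {..<N}" for N x
  have "continuous_on UNIV (p N)" for N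
    unfolding p_def L2_set_def
    by (intro continuous_intros linear_continuous_on bounded_linear_inner_left)
  moreover have "p N (x - y) \<le> p N x + p N y" for N x y
  proof -
    have "p N (x - y) \<le> L2_set (\<lambda>n. norm (ip x (b n)) + norm (ip y (b n))) {..<N}"
      unfolding p_def inner_diff_left by (intro L2_set_mono norm_triangle_ineq4) auto
    also have "\<dots> \<le> p N x + p N y" unfolding p_def by (rule L2_set_triangle_ineq)
    finally show ?thesis .
  qed
  moreover have "p N (r *\<^sub>R x) = \<bar>r\<bar> * p N x" for N r x
    unfolding p_def inner_scaleR_left by (simp add: norm_mult L2_set_right_distrib)
  moreover have "\<exists>k. \<forall>N. p N x \<le> k" for x
  proof -
    have "p N x \<le> ell2_norm (\<lambda>n. ip x (b n))" for N
      unfolding p_def L2_set_def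
      by (intro real_le_lsqrt ell2_norm_nonneg assms ell2_sum_le)
    then show ?thesis by blast
  qed
  ultimately obtain D where D: "D \<ge> 0" "\<And>N x. p N x \<le> D * norm x"
    using uniform_boundedness_seminorms[of p] by blast
  have "(\<Sum>n<N. (norm (ip x (b n)))\<^sup>2) \<le> (D * norm x)\<^sup>2" for x N
    using power_mono[OF D(2)[of N x], of 2] by (simp add: p_def L2_set_def sum_nonneg)
  then have "bessel b D" using D(1) by (simp add: bessel_def)
  then show thesis by (rule that)
qed

text \<open>Duality: pair the sum y with itself, apply Cauchy-Schwarz to the coefficients and cancel
  one factor of the norm of y. General finite sets are allowed because the Cauchy criterion needs
  blocks \<open>{m..<n}\<close>.\<close>

lemma bessel_synthesis:
  assumes "bessel b D" "finite F"
  shows "norm (\<Sum>n\<in>F. smul (a n) (b n)) \<le> D * L2_set (\<lambda>n. norm (a n)) F"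
proof -
  define y where "y = (\<Sum>n\<in>F. smul (a n) (b n))"
  obtain N where N: "F \<subseteq> {..<N}"
    using finite_nat_bounded[OF assms(2)] by blast
  have an: "L2_set (\<lambda>n. norm (ip y (b n))) F \<le> D * norm y"
  proof -
    have "(\<Sum>n\<in>F. (norm (ip y (b n)))\<^sup>2) \<le> (\<Sum>n<N. (norm (ip y (b n)))\<^sup>2)"
      using N by (intro sum_mono2) auto
    also have "\<dots> \<le> (D * norm y)\<^sup>2" using assms(1) by (simp add: bessel_def)
    finally show ?thesis
      unfolding L2_set_def using assms(1) by (intro real_le_lsqrt) (auto simp: bessel_def)
  qed
  have "(norm y)\<^sup>2 = norm (ip y y)" by (simp add: inner_self del: of_real_power)
  also have "\<dots> = norm (\<Sum>n\<in>F. a n * ip (b n) y)"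
    using arg_cong[OF y_def, of "\<lambda>v. ip v y"] by (simp add: inner_sum_left inner_smul_left)
  also have "\<dots> \<le> (\<Sum>n\<in>F. \<bar>norm (a n)\<bar> * \<bar>norm (ip y (b n))\<bar>)"
    by (rule norm_sum[THEN order_trans]) (simp add: norm_mult norm_inner_commute[of y])
  also have "\<dots> \<le> L2_set (\<lambda>n. norm (a n)) F * L2_set (\<lambda>n. norm (ip y (b n))) F"
    by (rule L2_set_mult_ineq)
  also have "\<dots> \<le> L2_set (\<lambda>n. norm (a n)) F * (D * norm y)"
    by (intro mult_left_mono an) simp
  finally have "norm y * norm y \<le> (D * L2_set (\<lambda>n. norm (a n)) F) * norm y"
    by (simp add: power2_eq_square mult_ac)
  then have "norm y \<le> D * L2_set (\<lambda>n. norm (a n)) F" if "norm y > 0"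
    using that by simp
  moreover have "D \<ge> 0" using assms(1) by (simp add: bessel_def)
  ultimately show ?thesis unfolding y_def[symmetric] by (cases "y = 0") auto
qed

text \<open>The converse duality: with the coefficients \<open>a n = ip x (b n)\<close>, pairing
  \<open>x\<close> with the synthesised vector returns the sum of |a_n|^2.\<close>

lemma synthesis_imp_bessel:
  assumes "D \<ge> 0"
    and syn: "\<And>a N. norm (\<Sum>n<N. smul (a n) (b n)) \<le> D * L2_set (\<lambda>n. norm (a n)) {..<N}"
  shows "bessel b D"
  unfolding bessel_def
proof (intro conjI allI assms(1))
  fix x N
  define a where "a n = ip x (b n)" for n
  define s where "s = L2_set (\<lambda>n. norm (a n)) {..<N}"
  have s2: "s\<^sup>2 = (\<Sum>n<N. (norm (a n))\<^sup>2)" by (simp add: s_def L2_set_def sum_nonneg)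
  have "ip x (\<Sum>n<N. smul (a n) (b n)) = (\<Sum>n<N. a n * scalar_cnj (a n))"
    by (simp add: inner_sum_right inner_smul_right mult.commute flip: a_def)
  also have "\<dots> = of_real (s\<^sup>2)"
    unfolding s2 mult_scalar_cnj by (simp add: scaleR_conv_of_real)
  finally have "s\<^sup>2 = norm (ip x (\<Sum>n<N. smul (a n) (b n)))" by (simp add: norm_power)
  also have "\<dots> \<le> norm x * (D * s)"
    unfolding s_def by (rule order_trans[OF Cauchy_Schwarz mult_left_mono[OF syn]]) simp
  finally have "s * s \<le> (D * norm x) * s" by (simp add: power2_eq_square mult_ac)
  moreover have "s \<ge> 0" by (simp add: s_def)
  ultimately have "s \<le> D * norm x"
    using assms(1) by (cases "s = 0") (auto simp: mult_le_cancel_right)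
  then have "s\<^sup>2 \<le> (D * norm x)\<^sup>2" by (intro power_mono) (auto simp: s_def)
  then show "(\<Sum>n<N. (norm (ip x (b n)))\<^sup>2) \<le> (D * norm x)\<^sup>2" by (simp add: s2 a_def)
qed

lemma bessel_analysis:
  assumes "bessel b D"
  shows "(\<lambda>n. ip x (b n)) \<in> ell2" and "ell2_norm (\<lambda>n. ip x (b n)) \<le> D * norm x"
  using ell2_boundedI[of "\<lambda>n. ip x (b n)" "D * norm x"] assms by (auto simp: bessel_def)

lemma bessel_summable:
  assumes b: "bessel b D" and a: "a \<in> ell2"
  shows "summable (\<lambda>n. smul (a n) (b n))"
  unfolding summable_Cauchy
proof (intro allI impI)
  fix e :: real assume "e > 0"
  have D: "D \<ge> 0" using b by (simp add: bessel_def)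
  have "summable (\<lambda>n. (norm (a n))\<^sup>2)" using a by (simp add: ell2_def)
  \<comment> \<open>Dividing by \<open>D + 1\<close> covers the case \<open>D = 0\<close>.\<close>
  moreover have "(e / (D + 1))\<^sup>2 > 0" using \<open>e > 0\<close> D by simp
  ultimately obtain N where N: "\<And>m n. m \<ge> N \<Longrightarrow> norm (\<Sum>i=m..<n. (norm (a i))\<^sup>2) < (e / (D + 1))\<^sup>2"
    unfolding summable_Cauchy by blast
  have "norm (\<Sum>i=m..<n. smul (a i) (b i)) < e" if "m \<ge> N" for m n
  proof -
    have "L2_set (\<lambda>i. norm (a i)) {m..<n} < e / (D + 1)"
      unfolding L2_set_def using N[OF that, of n] \<open>e > 0\<close> D
      by (intro real_less_lsqrt) (auto simp: sum_nonneg)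
    then have "(D + 1) * L2_set (\<lambda>i. norm (a i)) {m..<n} < e"
      using D by (simp add: field_simps)
    moreover have "D * L2_set (\<lambda>i. norm (a i)) {m..<n} \<le> (D + 1) * L2_set (\<lambda>i. norm (a i)) {m..<n}"
      by (intro mult_right_mono) auto
    ultimately show ?thesis using bessel_synthesis[OF b, of "{m..<n}" a] by simp
  qed
  then show "\<exists>N. \<forall>m\<ge>N. \<forall>n. norm (\<Sum>i=m..<n. smul (a i) (b i)) < e" by blast
qed

text \<open>The numbers \<open>ip f (R (unit_seq n))\<close> are the coordinates of the adjoint of
  \<open>R\<close> at \<open>f\<close>. Both sides expand into the series with terms
  \<open>ip x (b n) * ip (R (unit_seq n)) f\<close>.\<close>

lemma inner_dual_synthesis:
  assumes R: "ell2_bounded_op smul R" and b: "bessel b D"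
    and t: "(\<lambda>n. ip f (R (unit_seq n))) \<in> ell2"
  shows "ip x (\<Sum>n. smul (ip f (R (unit_seq n))) (b n)) = ip (R (\<lambda>n. ip x (b n))) f"
proof (rule sums_unique2)
  show "(\<lambda>n. ip x (smul (ip f (R (unit_seq n))) (b n)))
      sums ip x (\<Sum>n. smul (ip f (R (unit_seq n))) (b n))"
    by (intro bounded_linear.sums[OF bounded_linear_inner_right] summable_sums bessel_summable[OF b t])
  have "(\<lambda>n. ip (smul (ip x (b n)) (R (unit_seq n))) f) sums ip (R (\<lambda>n. ip x (b n))) f"
    by (intro bounded_linear.sums[OF bounded_linear_inner_left] ell2_bounded_op_sums[OF R]
        bessel_analysis[OF b])
  then show "(\<lambda>n. ip x (smul (ip f (R (unit_seq n))) (b n))) sums ip (R (\<lambda>n. ip x (b n))) f"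
    by (simp add: inner_smul_left inner_smul_right mult.commute flip: inner_cnj_commute)
qed

section \<open>Perturbation of a stably recovering sequence\<close>

lemma stable_recovery_perturbation:
  assumes R: "ell2_bounded_op smul R"
    and ell2: "\<And>f. (\<lambda>n. ip f (b n)) \<in> ell2"
    and recover: "\<And>f. R (\<lambda>n. ip f (b n)) = f"
    and \<alpha>: "0 \<le> \<alpha>" "\<alpha> < 1" and \<beta>: "0 \<le> \<beta>" "\<beta> < 1"
    and pert: "\<And>a N. (norm (\<Sum>n<N. smul (a n) (b n - b' n)))\<^sup>2
        \<le> \<alpha> * (norm (\<Sum>n<N. smul (a n) (b n)))\<^sup>2 + \<beta> * (norm (\<Sum>n<N. smul (a n) (b' n)))\<^sup>2"
  obtains R' where "ell2_bounded_op smul R'"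
    and "\<And>f. (\<lambda>n. ip f (b' n)) \<in> ell2" and "\<And>f. R' (\<lambda>n. ip f (b' n)) = f"
proof -
  have diff: "(\<Sum>n<N. smul (a n) (b n - b' n))
      = (\<Sum>n<N. smul (a n) (b n)) - (\<Sum>n<N. smul (a n) (b' n))" for a N
    by (simp add: scale_right_diff_distrib sum_subtractf)
  obtain D where b: "bessel b D" using pointwise_ell2_imp_bessel[OF ell2] .
  have "D \<ge> 0" using b by (simp add: bessel_def)
  define q where "q = 2 / (1 - sqrt \<beta>)"
  have "q \<ge> 0" using \<beta> by (simp add: q_def)
  have b': "bessel b' (q * D)"
  \<comment> \<open>On finite sums, \<open>norm_le_weighted_sum\<close> bounds synthesis with
    \<open>b'\<close> by \<open>q\<close> times synthesis with \<open>b\<close>, so the bound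
    \<open>D\<close> becomes \<open>q * D\<close>.\<close>
  proof (rule synthesis_imp_bessel)
    fix a N
    define u v where "u = (\<Sum>n<N. smul (a n) (b n))" and "v = (\<Sum>n<N. smul (a n) (b' n))"
    have "norm v \<le> norm u + norm (u - v)"
      using norm_triangle_ineq[of u "v - u"] by (simp add: norm_minus_commute)
    then have "norm v \<le> q * norm u"
      unfolding q_def using pert[of a N] \<alpha> \<beta> unfolding diff u_def[symmetric] v_def[symmetric]
      by (intro norm_le_weighted_sum[of _ _ "norm (u - v)"]) auto
    also have "\<dots> \<le> q * (D * L2_set (\<lambda>n. norm (a n)) {..<N})"
      unfolding u_def using \<open>q \<ge> 0\<close> by (intro mult_left_mono bessel_synthesis[OF b]) auto
    finally show "norm v \<le> q * D * L2_set (\<lambda>n. norm (a n)) {..<N}" by (simp add: mult.assoc)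
  qed (use \<open>q \<ge> 0\<close> \<open>D \<ge> 0\<close> in simp)
  obtain K where K: "K \<ge> 0" "\<And>c. c \<in> ell2 \<Longrightarrow> norm (R c) \<le> K * ell2_norm c"
    using ell2_bounded_op_bounded[OF R] by blast
  define t where "t f n = ip f (R (unit_seq n))" for f n
  \<comment> \<open>Synthesis with the vectors \<open>R (unit_seq n)\<close> is \<open>R\<close> on
    truncated sequences, so the bound of \<open>R\<close> is a Bessel bound and the adjoint
    coefficients \<open>t f\<close> lie in \<open>ell2\<close>.\<close>
  have "bessel (\<lambda>n. R (unit_seq n)) K"
  proof (rule synthesis_imp_bessel[OF K(1)])
    show "norm (\<Sum>n<N. smul (a n) (R (unit_seq n))) \<le> K * L2_set (\<lambda>n. norm (a n)) {..<N}" for a N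
      using K(2)[OF truncate_ell2, of N a]
      by (simp add: ell2_bounded_op_truncate[OF R] ell2_norm_truncate L2_set_def)
  qed
  then have t: "t f \<in> ell2" for f
    unfolding t_def by (rule bessel_analysis)

  define M where "M f = R (\<lambda>n. ip f (b' n))" for f
  have M_add: "M (x + y) = M x + M y" for x y
    unfolding M_def inner_add_left by (intro ell2_bounded_op_add[OF R] bessel_analysis[OF b'])
  have M_smul: "M (smul a x) = smul a (M x)" for a x
    unfolding M_def inner_smul_left by (intro ell2_bounded_op_mult[OF R] bessel_analysis[OF b'])
  have "norm (M x) \<le> norm x * (K * (q * D))" for x
  proof -
    have "norm (M x) \<le> K * ell2_norm (\<lambda>n. ip x (b' n))"
      unfolding M_def by (intro K bessel_analysis[OF b'])
    also have "\<dots> \<le> K * (q * D * norm x)"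
      by (intro mult_left_mono bessel_analysis[OF b'] K)
    finally show ?thesis by (simp add: mult_ac)
  qed
  then have M: "bounded_linear M"
    using M_smul[of "of_real _"] by (intro bounded_linear_intro[where K = "K * (q * D)"] M_add)
      (simp_all add: smul_of_real)

  \<comment> \<open>In the expansion of |f - v|^2 \<le> \<alpha>|f|^2 + \<beta>|v|^2, \<beta> < 1
    lets |v|^2 cancel; what remains is (1 - \<alpha>)|f|^2 \<le> 2 Re <f, v>, and <f, v> = <M f,
    f>.\<close>
  define c where "c = (1 - \<alpha>) / 2"
  have "c > 0" using \<alpha> by (simp add: c_def)
  have coercive: "c * (norm f)\<^sup>2 \<le> re_part (ip (M f) f)" for f
  proof -
    define v where "v = (\<Sum>n. smul (t f n) (b' n))"
    \<comment> \<open>As \<open>R\<close> inverts the analysis operator of \<open>b\<close>, its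
      adjoint is a right inverse of synthesis with \<open>b\<close>.\<close>
    have "ip x (\<Sum>n. smul (t f n) (b n)) = ip x f" for x
      using inner_dual_synthesis[OF R b t[unfolded t_def]] by (simp add: recover t_def)
    then have "(\<Sum>n. smul (t f n) (b n)) = f" by (rule inner_eq_imp_eq)
    then have f: "(\<lambda>N. \<Sum>n<N. smul (t f n) (b n)) \<longlonglongrightarrow> f"
      using summable_sums[OF bessel_summable[OF b t[of f]]] by (simp add: sums_def)
    have v: "(\<lambda>N. \<Sum>n<N. smul (t f n) (b' n)) \<longlonglongrightarrow> v"
      using summable_sums[OF bessel_summable[OF b' t[of f]]] by (simp add: sums_def v_def)
    have fv: "ip f v = ip (M f) f"
      using inner_dual_synthesis[OF R b' t[unfolded t_def]] by (simp add: v_def M_def t_def)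
    \<comment> \<open>The perturbation bound is known for finite sums; both sides pass to the
      limit.\<close>
    have "(norm (f - v))\<^sup>2 \<le> \<alpha> * (norm f)\<^sup>2 + \<beta> * (norm v)\<^sup>2"
    proof (rule LIMSEQ_le)
      show "(\<lambda>N. (norm ((\<Sum>n<N. smul (t f n) (b n)) - (\<Sum>n<N. smul (t f n) (b' n))))\<^sup>2)
          \<longlonglongrightarrow> (norm (f - v))\<^sup>2"
        by (intro tendsto_intros f v)
      show "(\<lambda>N. \<alpha> * (norm (\<Sum>n<N. smul (t f n) (b n)))\<^sup>2
          + \<beta> * (norm (\<Sum>n<N. smul (t f n) (b' n)))\<^sup>2) \<longlonglongrightarrow> \<alpha> * (norm f)\<^sup>2 + \<beta> * (norm v)\<^sup>2"
        by (intro tendsto_intros f v)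
    qed (use pert in \<open>auto simp: diff\<close>)
    moreover have "\<beta> * (norm v)\<^sup>2 \<le> 1 * (norm v)\<^sup>2" using \<beta> by (intro mult_right_mono) auto
    ultimately show ?thesis by (simp add: norm_diff_sq fv c_def field_simps)
  qed
  note lower = coercive_bij(2)[OF M \<open>c > 0\<close> coercive]
  have "bij M" using coercive_bij(1)[OF M \<open>c > 0\<close> coercive] .
  define T where "T = inv M"
  have MT: "M (T x) = x" and TM: "T (M x) = x" for x
    using \<open>bij M\<close> by (simp_all add: T_def bij_is_surj surj_f_inv_f bij_is_inj)
  have T_add: "T (x + y) = T x + T y" for x y by (metis MT TM M_add)
  have T_smul: "T (smul a x) = smul a (T x)" for a x by (metis MT TM M_smul)
  have "norm (T x) \<le> norm x * (1 / c)" for x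
    using lower[of "T x"] \<open>c > 0\<close> by (simp add: MT field_simps)
  then have T: "bounded_linear T"
    using T_smul[of "of_real _"] by (intro bounded_linear_intro[where K = "1 / c"] T_add)
      (simp_all add: smul_of_real)
  show thesis
  proof (rule that)
    show "ell2_bounded_op smul (\<lambda>c. T (R c))" by (rule ell2_bounded_op_compose[OF R T T_smul])
    show "(\<lambda>n. ip f (b' n)) \<in> ell2" for f by (rule bessel_analysis[OF b'])
    show "T (R (\<lambda>n. ip f (b' n))) = f" for f using TM[of f] by (simp add: M_def)
  qed
qed

section \<open>Orbits under the adjoints and reduction to the perturbation result\<close>

lemma funpow_hilbert_adj_diff:
  assumes "hilbert_op smul A"
  shows "(hilbert_adj ip A ^^ n) (x - y) = (hilbert_adj ip A ^^ n) x - (hilbert_adj ip A ^^ n) y"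
proof (rule inner_eq_imp_eq)
  have adj: "ip z ((hilbert_adj ip A ^^ n) u) = ip ((A ^^ n) z) u" for z u
    using fun_cong[OF samples_eq[OF assms, of u z], of n] by (simp add: samples_def)
  show "ip z ((hilbert_adj ip A ^^ n) (x - y))
      = ip z ((hilbert_adj ip A ^^ n) x - (hilbert_adj ip A ^^ n) y)" for z
    by (simp add: adj inner_diff_right)
qed

end

theorem theorem3p11:
  fixes smul :: "'k::hilbert_scalar \<Rightarrow> 'h::banach \<Rightarrow> 'h"
    and ip :: "'h \<Rightarrow> 'h \<Rightarrow> 'k"
    and A B :: "'h \<Rightarrow> 'h"
    and g h :: 'h
    and lam mu nu eps :: real
  assumes "hilbert_space smul ip"
    and "separable_space (euclidean :: 'h topology)"
    and "hilbert_op smul A" and "hilbert_op smul B"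
    and "stably_recoverable smul ip A g"
    and "lam \<ge> 0" and "mu \<ge> 0" and "nu \<ge> 0"
    and "\<And>(l::nat) (a :: nat \<Rightarrow> 'k).
           (norm (\<Sum>n=0..l. smul (a n) ((hilbert_adj ip A ^^ n) (g - h))))\<^sup>2
           + (norm (\<Sum>n=0..l. smul (a n)
                 ((hilbert_adj ip A ^^ n) h - (hilbert_adj ip B ^^ n) h)))\<^sup>2
           \<le> lam * (norm (\<Sum>n=0..l. smul (a n) ((hilbert_adj ip A ^^ n) g)))\<^sup>2
             + mu * norm (\<Sum>n=0..l. smul (a n) ((hilbert_adj ip A ^^ n) g))
                  * norm (\<Sum>n=0..l. smul (a n) ((hilbert_adj ip B ^^ n) h))
             + nu * (norm (\<Sum>n=0..l. smul (a n) ((hilbert_adj ip B ^^ n) h)))\<^sup>2"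
    and "eps > 0"
    and "2 * (1 - 3 * nu) * eps - 3 * mu > 0"
    and "max (2 * lam + mu * eps) (mu / eps + 2 * nu) < 1"
  shows "stably_recoverable smul ip B h"
proof -
  interpret hilbert_space smul ip by fact
  define b b' where "b n = (hilbert_adj ip A ^^ n) g" and "b' n = (hilbert_adj ip B ^^ n) h" for n
  have samples_A: "samples ip A g f = (\<lambda>n. ip f (b n))" for f
    unfolding b_def by (rule samples_eq) fact
  have samples_B: "samples ip B h f = (\<lambda>n. ip f (b' n))" for f
    unfolding b'_def by (rule samples_eq) fact
  \<comment> \<open>The factor 2 comes from |x + y|^2 \<le> 2(|x|^2 + |y|^2), and the doubled cross
    term 2 mu u v is split as mu (eps u^2 + v^2 / eps).\<close>
  define \<alpha> \<beta> where "\<alpha> = 2 * lam + mu * eps" and "\<beta> = mu / eps + 2 * nu"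
  have \<alpha>\<beta>: "0 \<le> \<alpha>" "\<alpha> < 1" "0 \<le> \<beta>" "\<beta> < 1"
    using assms(6-8,10,12) by (auto simp: \<alpha>_def \<beta>_def)
  have pert: "(norm (\<Sum>n<N. smul (a n) (b n - b' n)))\<^sup>2
      \<le> \<alpha> * (norm (\<Sum>n<N. smul (a n) (b n)))\<^sup>2 + \<beta> * (norm (\<Sum>n<N. smul (a n) (b' n)))\<^sup>2" for a N
  \<comment> \<open>The hypothesis sums over 0, ..., l and so covers \<open>N = Suc l\<close>; for
    \<open>N = 0\<close> all sums are empty.\<close>
  proof (cases N)
    case (Suc l)
    define x where "x = (\<Sum>n<N. smul (a n) ((hilbert_adj ip A ^^ n) (g - h)))"
    define y where "y = (\<Sum>n<N. smul (a n) ((hilbert_adj ip A ^^ n) h - b' n))"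
    define u where "u = norm (\<Sum>n<N. smul (a n) (b n))"
    define v where "v = norm (\<Sum>n<N. smul (a n) (b' n))"
    have N: "{0..l} = {..<N}" using Suc by auto
    have hyp: "(norm x)\<^sup>2 + (norm y)\<^sup>2 \<le> lam * u\<^sup>2 + mu * u * v + nu * v\<^sup>2"
      using assms(9)[of a l] unfolding N by (simp add: x_def y_def u_def v_def b_def b'_def)
    \<comment> \<open>Insert the n-th power of the adjoint of \<open>A\<close> at \<open>h\<close>
      between \<open>b n\<close> and \<open>b' n\<close>; this splits the difference into the two
      sums of the hypothesis.\<close>
    have "(\<Sum>n<N. smul (a n) (b n - b' n)) = x + y"
      unfolding x_def y_def sum.distrib[symmetric] scale_right_distrib[symmetric]
      by (simp add: funpow_hilbert_adj_diff[OF assms(3)] b_def)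
    moreover have "(norm (x + y))\<^sup>2 \<le> 2 * ((norm x)\<^sup>2 + (norm y)\<^sup>2)"
      using zero_le_power2[of "norm (x - y)"] unfolding norm_add_sq norm_diff_sq by simp
    moreover have "2 * (u * v) \<le> eps * u\<^sup>2 + v\<^sup>2 / eps"
    proof -
      have "0 \<le> (eps * u - v)\<^sup>2 / eps" using assms(10) by simp
      also have "\<dots> = eps * u\<^sup>2 + v\<^sup>2 / eps - 2 * (u * v)"
        using assms(10) by (simp add: power2_diff field_simps power2_eq_square)
      finally show ?thesis by simp
    qed
    then have "mu * (2 * (u * v)) \<le> mu * (eps * u\<^sup>2 + v\<^sup>2 / eps)"
      using assms(7) by (rule mult_left_mono)
    ultimately show ?thesis
      using hyp by (simp add: \<alpha>_def \<beta>_def flip: u_def v_def) (simp add: algebra_simps)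
  qed simp
  obtain R where R: "ell2_bounded_op smul R" "\<And>f. R (\<lambda>n. ip f (b n)) = f"
    and ell2: "\<And>f. (\<lambda>n. ip f (b n)) \<in> ell2"
    using assms(5) unfolding stably_recoverable_def samples_A by blast
  obtain R' where "ell2_bounded_op smul R'"
    "\<And>f. (\<lambda>n. ip f (b' n)) \<in> ell2" "\<And>f. R' (\<lambda>n. ip f (b' n)) = f"
    by (rule stable_recovery_perturbation[OF R(1) ell2 R(2) \<alpha>\<beta> pert]) blast
  then show ?thesis unfolding stably_recoverable_def samples_B by blast
qed

end
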